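(* Let $R$ be a commutative ring with identity containing $\mathbb{Q}$ and let $N\ge2$ be an integer. If $p\in R[X_1,\ldots,X_N]$ is harmonic, then $$\lambda_0(p)=p(0).$$
   Context: $\partial_j=\partial/\partial X_j$, $\Delta=\partial_1^2+\cdots+\partial_N^2$; $p$ is harmonic if $\Delta p=0$; $p(0)$ is the constant term of $p$. $M_{jk}=X_j\partial_k-X_k\partial_j$ for distinct $j,k\in\{1,\ldots,N\}$. $\lambda_0\colon R[X_1,\ldots,X_N]\to R$ (the normalized spherical mean) denotes the unique $R$-linear map such that $\lambda_0\circ M_{jk}=0$ for all $j\ne k$ and $\lambda_0\bigl((X_1^2+\cdots+X_N^2)^n\bigr)=1$ for all integers $n\ge0$ (it exists and is unique). *)

theory Defs
  imports Complex_Main "HOL-Library.Poly_Mapping" "HOL-Library.Cardinality"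
begin

text \<open>
  Polynomials over \<open>'r\<close> in indeterminates indexed by a finite type \<open>'n\<close> (so the number \<open>N\<close> of
  indeterminates is \<open>CARD('n)\<close>): finitely supported maps from exponent vectors to
  coefficients, with the convolution product of \<^theory>\<open>HOL-Library.Poly_Mapping\<close>.
\<close>

type_synonym ('n, 'r) mpoly = "('n \<Rightarrow>\<^sub>0 nat) \<Rightarrow>\<^sub>0 'r"

definition Const :: "'r::comm_ring_1 \<Rightarrow> ('n::finite, 'r) mpoly"
  where "Const c = Poly_Mapping.single 0 c"

definition Var :: "'n::finite \<Rightarrow> ('n, 'r::comm_ring_1) mpoly"
  where "Var j = Poly_Mapping.single (Poly_Mapping.single j 1) 1"

definition constant_term :: "('n::finite, 'r::comm_ring_1) mpoly \<Rightarrow> 'r"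
  where "constant_term p = Poly_Mapping.lookup p 0"

text \<open>
  The exponent subtraction is truncated, which is harmless: if \<open>j\<close> does not occur in
  the monomial \<open>m\<close>, the coefficient vanishes.
\<close>

definition partial :: "'n::finite \<Rightarrow> ('n, 'r::comm_ring_1) mpoly \<Rightarrow> ('n, 'r) mpoly"
  where "partial j p =
    (\<Sum>m\<in>Poly_Mapping.keys p.
       Poly_Mapping.single (m - Poly_Mapping.single j 1)
         (of_nat (Poly_Mapping.lookup m j) * Poly_Mapping.lookup p m))"

lemma lookup_partial:
  "Poly_Mapping.lookup (partial j p) m =
     of_nat (Poly_Mapping.lookup m j + 1) * Poly_Mapping.lookup p (m + Poly_Mapping.single j 1)"
proof -
  let ?e = "Poly_Mapping.single j (1::nat)"
  have A: "(m' - ?e = m \<and> Poly_Mapping.lookup m' j \<noteq> 0) \<longleftrightarrow> m' = m + ?e" for m'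
    by (auto intro!: poly_mapping_eqI simp: lookup_add lookup_minus lookup_single when_def)
  have "Poly_Mapping.lookup (partial j p) m = (\<Sum>m'\<in>Poly_Mapping.keys p. if m' = m + ?e then of_nat (Poly_Mapping.lookup m' j) * Poly_Mapping.lookup p m' else 0)"
    unfolding partial_def lookup_sum
  proof (rule sum.cong)
    fix m'
    show "Poly_Mapping.lookup (Poly_Mapping.single (m' - ?e)
              (of_nat (Poly_Mapping.lookup m' j) * Poly_Mapping.lookup p m')) m =
            (if m' = m + ?e then of_nat (Poly_Mapping.lookup m' j) * Poly_Mapping.lookup p m' else 0)"
      using A[of m'] by (cases "Poly_Mapping.lookup m' j = 0") (simp_all add: lookup_single when_def)
  qed simp
  also have "\<dots> = of_nat (Poly_Mapping.lookup m j + 1) * Poly_Mapping.lookup p (m + ?e)"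
    by (simp add: sum.delta lookup_add lookup_single in_keys_iff)
  finally show ?thesis .
qed

definition laplacian :: "('n::finite, 'r::comm_ring_1) mpoly \<Rightarrow> ('n, 'r) mpoly"
  where "laplacian p = (\<Sum>j\<in>UNIV. partial j (partial j p))"

definition harmonic :: "('n::finite, 'r::comm_ring_1) mpoly \<Rightarrow> bool"
  where "harmonic p \<longleftrightarrow> laplacian p = 0"

definition rot :: "'n::finite \<Rightarrow> 'n \<Rightarrow> ('n, 'r::comm_ring_1) mpoly \<Rightarrow> ('n, 'r) mpoly"
  where "rot j k p = Var j * partial k p - Var k * partial j p"

definition is_spherical_mean :: "(('n::finite, 'r::comm_ring_1) mpoly \<Rightarrow> 'r) \<Rightarrow> bool"
  where "is_spherical_mean L \<longleftrightarrow>
    module_hom (\<lambda>c p. Const c * p) (*) L \<and>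
    (\<forall>j k p. j \<noteq> k \<longrightarrow> L (rot j k p) = 0) \<and>
    (\<forall>n::nat. L ((\<Sum>j\<in>UNIV. Var j ^ 2) ^ n) = 1)"

text \<open>
  The description is proper (existence and uniqueness hold) whenever \<open>'r\<close> contains the
  rationals and \<open>'n\<close> has at least two elements.
\<close>

definition spherical_mean :: "('n::finite, 'r::comm_ring_1) mpoly \<Rightarrow> 'r"
  where "spherical_mean = (THE L. is_spherical_mean L)"

definition contains_rat :: "'r::comm_ring_1 itself \<Rightarrow> bool"
  where "contains_rat _ \<longleftrightarrow>
    (\<exists>h :: rat \<Rightarrow> 'r. inj h \<and> h 1 = 1 \<and>
       (\<forall>x y. h (x + y) = h x + h y) \<and> (\<forall>x y. h (x * y) = h x * h y))"

end

theory Submission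
  imports Defs
begin

text \<open>
  With $r^2 = \sum_j X_j^2$ and the Euler operator $E = \sum_j X_j\partial_j$, one has
  $\frac12\sum_{j,k} M_{jk}^2 = r^2\Delta - E(E + N - 2)$, and every $M_{jk}$ commutes with
  multiplication by $r^2$. Hence a linear map $L$ that kills all rotations satisfies
  $L(r^{2n} E(E+N-2)q) = L(r^{2n+2}\Delta q)$. On forms of degree $d > 0$ the operator $E(E+N-2)$ is
  the invertible scalar $d(d+N-2)$. By induction on the degree, this determines $L$ from its values on
  the powers of $r^2$; for harmonic $p$ and $n = 0$ it shows that $L$ kills $p - p(0)$.
  A spherical mean exists because the moments of the normal distribution, divided by
  $N(N+2)\cdots(N+d-2)$ in degree $d$, define one.
\<close>

section \<open>Polynomials and derivations\<close>

abbreviation "lookup \<equiv> Poly_Mapping.lookup"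
abbreviation "single \<equiv> Poly_Mapping.single"
abbreviation "keys \<equiv> Poly_Mapping.keys"

text \<open>Every polynomial is the sum of its terms, so identities between additive maps need
  checking on monomials only. This replaces induction on polynomials throughout.\<close>

lemma additive_eqI:
  fixes f g :: "('a \<Rightarrow>\<^sub>0 'b::ab_group_add) \<Rightarrow> 'c::ab_group_add"
  assumes "additive f" "additive g" and eq: "\<And>m a. f (single m a) = g (single m a)"
  shows "f p = g p"
proof -
  have "f (\<Sum>m\<in>keys p. single m (lookup p m)) = g (\<Sum>m\<in>keys p. single m (lookup p m))"
    by (simp only: additive.sum[OF assms(1)] additive.sum[OF assms(2)] eq)
  moreover have "(\<Sum>m\<in>keys p. single m (lookup p m)) = p"
    by (rule poly_mapping_eqI) (simp add: lookup_sum lookup_single when_def in_keys_iff)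
  ultimately show ?thesis by simp
qed

lemma partial_single:
  "partial j (single m a) = single (m - single j 1) (of_nat (lookup m j) * a)"
  by (cases "a = 0") (simp_all add: partial_def)

lemma partial_add: "partial j (p + q) = partial j p + partial j q"
  by (rule poly_mapping_eqI) (simp only: lookup_partial lookup_add distrib_left)

interpretation partial: additive "partial j"
  by standard (rule partial_add)

lemma partial_commute: "partial j (partial k p) = partial k (partial j p)"
proof (cases "j = k")
  case False
  show ?thesis
    by (rule poly_mapping_eqI)
      (use False in \<open>simp add: lookup_partial lookup_add lookup_single ac_simps\<close>)
qed simp

lemma partial_mult_single:
  "partial j (single m a * single n b) =
    partial j (single m a) * single n b + single m a * partial j (single n b)"
proof -
  \<comment> \<open>Exponent subtraction is truncated, so it may be moved past a sum only if
    \<open>j\<close> occurs in \<open>x\<close>. Otherwise the derivative of that factor is zero,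
    whence the case split below.\<close>
  have sub: "x - single j 1 + y = x + y - single j 1" if "lookup x j > 0" for x y :: "'a \<Rightarrow>\<^sub>0 nat"
    using that
    by (intro poly_mapping_eqI) (auto simp: lookup_add lookup_minus lookup_single when_def)
  show ?thesis
    using sub[of m n] sub[of n m]
    by (cases "lookup m j = 0"; cases "lookup n j = 0")
      (simp_all add: partial_single mult_single lookup_add single_add[symmetric] algebra_simps)
qed

lemma partial_mult:
  fixes p q :: "('n::finite, 'r::comm_ring_1) mpoly"
  shows "partial j (p * q) = partial j p * q + p * partial j q"
proof -
  have single: "partial j (single m a * q) = partial j (single m a) * q + single m a * partial j q"
    for m and a :: 'r
    by (rule additive_eqI[of "\<lambda>q. partial j (single m a * q)"
          "\<lambda>q. partial j (single m a) * q + single m a * partial j q"])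
      (unfold_locales, auto simp: partial_add distrib_left partial_mult_single)
  show ?thesis
    by (rule additive_eqI[of "\<lambda>p. partial j (p * q)" "\<lambda>p. partial j p * q + p * partial j q"])
      (unfold_locales, auto simp: partial_add distrib_right single)
qed

lemma partial_Var: "partial j (Var k) = (if j = k then 1 else 0)"
  by (simp add: Var_def partial_single lookup_single flip: single_one)

section \<open>Constants as scalars\<close>

lemma Const_add: "Const (a + b) = Const a + Const b"
  by (simp add: Const_def single_add)

lemma Const_mult: "Const (a * b) = Const a * Const b"
  by (simp add: Const_def mult_single)

lemma Const_1: "Const 1 = 1"
  by (simp add: Const_def)

lemma of_nat_eq_Const: "of_nat n = Const (of_nat n)"
  by (induction n) (simp_all add: Const_add Const_1 Const_def[of 0])

lemma Const_mult_single: "Const a * single m b = single m (a * b)"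
  by (simp add: Const_def mult_single)

lemma lookup_Const_mult: "lookup (Const a * p) m = a * lookup p m"
  by (rule additive_eqI[of "\<lambda>p. lookup (Const a * p) m" "\<lambda>p. a * lookup p m"])
    (unfold_locales, auto simp: lookup_add distrib_left Const_mult_single lookup_single when_def)

lemma lookup_of_nat_mult:
  fixes p :: "('n::finite, 'r::comm_ring_1) mpoly"
  shows "lookup (of_nat n * p) m = of_nat n * lookup p m"
  by (simp add: of_nat_eq_Const lookup_Const_mult)

lemma keys_Const_mult: "keys (Const a * p) \<subseteq> keys p"
  by (auto simp: in_keys_iff lookup_Const_mult)

section \<open>The Casimir identity\<close>

definition sq_norm :: "('n::finite, 'r::comm_ring_1) mpoly"
  where "sq_norm = (\<Sum>j\<in>UNIV. Var j ^ 2)"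

definition euler :: "('n::finite, 'r::comm_ring_1) mpoly \<Rightarrow> ('n, 'r) mpoly"
  where "euler p = (\<Sum>j\<in>UNIV. Var j * partial j p)"

definition total_degree :: "('n::finite \<Rightarrow>\<^sub>0 nat) \<Rightarrow> nat"
  where "total_degree m = (\<Sum>j\<in>UNIV. lookup m j)"

lemma total_degree_add: "total_degree (m + n) = total_degree m + total_degree n"
  by (simp add: total_degree_def lookup_add sum.distrib)

lemma total_degree_single: "total_degree (single j n) = n"
  by (simp add: total_degree_def lookup_single when_def)

lemma total_degree_0: "total_degree 0 = 0"
  by (simp add: total_degree_def)

lemma total_degree_eq_0_iff: "total_degree m = 0 \<longleftrightarrow> m = 0"
  by (auto simp: total_degree_def intro!: poly_mapping_eqI)

lemma minus_single_add:
  fixes m :: "'n \<Rightarrow>\<^sub>0 nat"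
  assumes "lookup m j > 0"
  shows "m - single j 1 + single j 1 = m"
  using assms
  by (intro poly_mapping_eqI) (auto simp: lookup_add lookup_minus lookup_single when_def)

lemma Var_mult_partial_single:
  "Var j * partial j (single m a) = single m (of_nat (lookup m j) * a)"
proof (cases "lookup m j = 0")
  case False
  then show ?thesis
    using minus_single_add[of m j] by (simp add: Var_def partial_single mult_single add.commute)
qed (simp add: partial_single)

lemma euler_add: "euler (p + q) = euler p + euler q"
  by (simp add: euler_def partial_add distrib_left sum.distrib)

text \<open>Euler's identity: monomials are eigenvectors, with the degree as eigenvalue. The
  coefficientwise form avoids splitting polynomials into homogeneous parts.\<close>

lemma lookup_euler: "lookup (euler p) m = of_nat (total_degree m) * lookup p m"
proof (rule additive_eqI[of "\<lambda>p. lookup (euler p) m" "\<lambda>p. of_nat (total_degree m) * lookup p m"])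
  fix m' a
  show "lookup (euler (single m' a)) m = of_nat (total_degree m) * lookup (single m' a) m"
    by (simp add: euler_def Var_mult_partial_single lookup_sum lookup_single when_def
        total_degree_def sum_distrib_right)
qed (unfold_locales, auto simp: euler_add lookup_add distrib_left)

lemma rot_mult: "rot j k (p * q) = rot j k p * q + p * rot j k q"
  by (simp add: rot_def partial_mult algebra_simps)

text \<open>The gradient of $r^2$ is $2X$, and $X_j X_k - X_k X_j = 0$.\<close>

lemma rot_sq_norm: "rot j k (sq_norm :: ('n::finite, 'r::comm_ring_1) mpoly) = 0"
proof -
  have "partial i (sq_norm :: ('n, 'r) mpoly) = 2 * Var i" for i
    by (simp add: sq_norm_def partial.sum power2_eq_square partial_mult partial_Var
        if_distrib[of "\<lambda>x. x * _"] if_distrib[of "\<lambda>x. _ * x"] sum.distrib cong: if_cong)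
  then show ?thesis by (simp add: rot_def)
qed

lemma rot_sq_norm_power_mult: "rot j k (sq_norm ^ n * p) = sq_norm ^ n * rot j k p"
proof (induction n)
  case (Suc n)
  have "rot j k (sq_norm ^ Suc n * p) = rot j k (sq_norm * (sq_norm ^ n * p))"
    by (simp add: mult.assoc)
  also have "\<dots> = sq_norm ^ Suc n * rot j k p"
    by (subst rot_mult) (simp add: rot_sq_norm Suc mult.assoc)
  finally show ?case .
qed simp

text \<open>The sum runs over ordered pairs, so each $M_{jk}^2 = M_{kj}^2$ is counted twice; hence
  the factor 2.\<close>

lemma sum_rot_rot:
  fixes p :: "('n::finite, 'r::comm_ring_1) mpoly"
  assumes "CARD('n) \<ge> 2"
  shows "(\<Sum>j\<in>UNIV. \<Sum>k\<in>UNIV. rot j k (rot j k p)) =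
    2 * (sq_norm * laplacian p - (euler (euler p) + of_nat (CARD('n) - 2) * euler p))"
proof -
  let ?X = "Var :: 'n \<Rightarrow> ('n, 'r) mpoly"
  let ?D = "\<lambda>j k. ?X j * ?X k * partial j (partial k p)"
  \<comment> \<open>The last summand corrects the diagonal, where \<open>rot j j\<close> vanishes,
    so that one formula serves all pairs and the double sums factor.\<close>
  have rot2: "rot j k (rot j k p) =
      ?X j ^ 2 * partial k (partial k p) + ?X k ^ 2 * partial j (partial j p)
      - ?X j * partial j p - ?X k * partial k p - 2 * ?D j k
      + (if j = k then 2 * (?X j * partial j p) else 0)" for j k
    by (auto simp: rot_def partial_mult partial.diff partial_Var power2_eq_square
        partial_commute[of k j] algebra_simps)
  have lap1: "(\<Sum>j\<in>UNIV. \<Sum>k\<in>UNIV. ?X j ^ 2 * partial k (partial k p)) = sq_norm * laplacian p"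
    unfolding sq_norm_def laplacian_def by (rule sum_product[symmetric])
  have lap2: "(\<Sum>j\<in>UNIV. \<Sum>k\<in>UNIV. ?X k ^ 2 * partial j (partial j p)) = sq_norm * laplacian p"
    using lap1 by (subst sum.swap)
  have "partial j (euler p) = partial j p + (\<Sum>k\<in>UNIV. ?X k * partial j (partial k p))" for j
    by (simp add: euler_def partial.sum partial_mult partial_Var sum.distrib
        if_distrib[of "\<lambda>x. x * _"] cong: if_cong)
  \<comment> \<open>This turns the mixed second-order terms into $E^2 - E$.\<close>
  then have euler2: "euler (euler p) = euler p + (\<Sum>j\<in>UNIV. \<Sum>k\<in>UNIV. ?D j k)"
    by (simp add: euler_def[of "euler p"] distrib_left sum.distrib sum_distrib_left mult.assoc)
      (simp add: euler_def)
  have eul1: "(\<Sum>j\<in>UNIV. \<Sum>k\<in>(UNIV :: 'n set). ?X j * partial j p) = of_nat (CARD('n)) * euler p"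
    by (simp add: euler_def flip: sum_distrib_left)
  have eul2: "(\<Sum>j\<in>(UNIV :: 'n set). \<Sum>k\<in>UNIV. ?X k * partial k p) = of_nat (CARD('n)) * euler p"
    by (simp add: euler_def)
  have diag: "(\<Sum>j\<in>UNIV. \<Sum>k\<in>UNIV. if j = k then 2 * (?X j * partial j p) else 0) = 2 * euler p"
    by (simp add: euler_def flip: sum_distrib_left)
  have card: "of_nat (CARD('n)) = of_nat (CARD('n) - 2) + (2 :: ('n, 'r) mpoly)"
    using assms by (simp add: of_nat_diff)
  have "(\<Sum>j\<in>UNIV. \<Sum>k\<in>UNIV. rot j k (rot j k p)) =
      2 * (sq_norm * laplacian p) - 2 * (of_nat (CARD('n)) * euler p)
      - 2 * (\<Sum>j\<in>UNIV. \<Sum>k\<in>UNIV. ?D j k) + 2 * euler p"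
    unfolding rot2 sum.distrib sum_subtractf lap1 lap2 eul1 eul2 diag
    by (simp add: sum_distrib_left mult.assoc)
  then show ?thesis
    unfolding card euler2 by (simp add: algebra_simps)
qed

section \<open>Linear maps that kill the rotations\<close>

lemma contains_rat_hom:
  assumes "contains_rat TYPE('r::comm_ring_1)"
  obtains h :: "rat \<Rightarrow> 'r::comm_ring_1" where "h 1 = 1" "\<And>x y. h (x + y) = h x + h y"
    "\<And>x y. h (x * y) = h x * h y" "\<And>n. h (of_nat n) = of_nat n" "h 0 = 0"
proof -
  obtain h :: "rat \<Rightarrow> 'r" where h: "h 1 = 1" "\<And>x y. h (x + y) = h x + h y"
    "\<And>x y. h (x * y) = h x * h y"
    using assms by (auto simp: contains_rat_def)
  have h0: "h 0 = 0"
    using h(2)[of 0 0] by simp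
  have "h (of_nat n) = of_nat n" for n
    by (induction n) (simp_all add: h h0)
  then show thesis using that h h0 by blast
qed

lemma of_nat_invertible:
  assumes "contains_rat TYPE('r::comm_ring_1)" "n > 0"
  obtains u :: "'r::comm_ring_1" where "u * of_nat n = 1"
proof -
  obtain h :: "rat \<Rightarrow> 'r" where h: "h 1 = 1" "\<And>x y. h (x * y) = h x * h y"
    "\<And>n. h (of_nat n) = of_nat n"
    using contains_rat_hom[OF assms(1)] by metis
  have "h (1 / of_nat n) * of_nat n = 1"
    using h(2)[of "1 / of_nat n" "of_nat n"] h(1,3) assms(2) by simp
  then show thesis by (rule that)
qed

text \<open>$R$ may have zero divisors, but positive integers are units and can be
  cancelled.\<close>

lemma of_nat_mult_eq_0_iff:
  fixes x :: "'r::comm_ring_1"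
  assumes "contains_rat TYPE('r)" "n > 0"
  shows "of_nat n * x = 0 \<longleftrightarrow> x = 0"
proof -
  obtain u :: 'r where "u * of_nat n = 1"
    using of_nat_invertible[OF assms] .
  then show ?thesis
    using mult.assoc[of u "of_nat n" x] by auto
qed

text \<open>The normalization on powers of $r^2$ is left out so that the difference of two spherical
  means is an instance as well.\<close>

locale rotation_invariant =
  fixes L :: "('n::finite, 'r::comm_ring_1) mpoly \<Rightarrow> 'r"
  assumes add: "L (p + q) = L p + L q"
    and Const_scale: "L (Const c * p) = c * L p"
    and rot: "j \<noteq> k \<Longrightarrow> L (rot j k p) = 0"
    and contains_rat: "contains_rat TYPE('r)"
    and card_ge_2: "CARD('n) \<ge> 2"
begin

sublocale additive L
  by standard (rule add)

lemma of_nat_scale: "L (of_nat n * p) = of_nat n * L p"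
  by (simp add: of_nat_eq_Const Const_scale)

lemma casimir_reduction:
  "L (sq_norm ^ n * (euler (euler p) + of_nat (CARD('n) - 2) * euler p)) =
    L (sq_norm ^ Suc n * laplacian p)"
proof -
  have "L (rot j k q) = 0" for j k q
    by (cases "j = k") (simp_all add: rot, simp add: rot_def zero)
  \<comment> \<open>The outer rotation is killed whatever it acts on, here $r^{2n} M_{jk} p$; then
    $r^{2n}$ is pulled out to reach the Casimir sum.\<close>
  then have "L (\<Sum>j\<in>UNIV. \<Sum>k\<in>UNIV. rot j k (sq_norm ^ n * rot j k p)) = 0"
    by (simp add: sum)
  also have "(\<Sum>j\<in>UNIV. \<Sum>k\<in>UNIV. rot j k (sq_norm ^ n * rot j k p)) =
      sq_norm ^ n * (\<Sum>j\<in>UNIV. \<Sum>k\<in>UNIV. rot j k (rot j k p))"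
    by (simp only: rot_sq_norm_power_mult sum_distrib_left)
  also have "\<dots> = of_nat 2 * (sq_norm ^ Suc n * laplacian p -
      sq_norm ^ n * (euler (euler p) + of_nat (CARD('n) - 2) * euler p))"
    by (simp add: sum_rot_rot[OF card_ge_2] algebra_simps)
  finally have "of_nat 2 * (L (sq_norm ^ Suc n * laplacian p) -
      L (sq_norm ^ n * (euler (euler p) + of_nat (CARD('n) - 2) * euler p))) = 0"
    by (simp only: of_nat_scale diff)
  then show ?thesis
    by (subst (asm) of_nat_mult_eq_0_iff[OF contains_rat]) simp_all
qed

text \<open>\<open>casimir_reduction\<close> trades $r^{2n} X^m$ for $r^{2n+2}$ times terms of lower
  degree, up to a unit. The induction therefore runs over the degree with \<open>n\<close> arbitrary
  and ends at constant multiples of powers of $r^2$.\<close>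

lemma zero_if_zero_on_sq_norm_powers:
  assumes "\<And>n. L (sq_norm ^ n) = 0"
  shows "L p = 0"
proof -
  have "L (sq_norm ^ n * single m a) = 0" for n m a
  proof (induction "total_degree m" arbitrary: n m a rule: less_induct)
    case less
    let ?d = "total_degree m" and ?p = "single m a :: ('n, 'r) mpoly"
    show ?case
    proof (cases "m = 0")
      case True
      then show ?thesis
        using Const_scale[of a "sq_norm ^ n"] assms by (simp add: Const_def mult.commute)
    next
      case False
      then have pos: "?d * (?d + (CARD('n) - 2)) > 0"
        using total_degree_eq_0_iff[of m] by simp
      have "euler (euler ?p) + of_nat (CARD('n) - 2) * euler ?p =
          of_nat (?d * (?d + (CARD('n) - 2))) * ?p"
        by (rule poly_mapping_eqI)
          (unfold lookup_add lookup_euler lookup_of_nat_mult, unfold of_nat_mult of_nat_add,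
            simp add: lookup_single when_def algebra_simps)
      then have "of_nat (?d * (?d + (CARD('n) - 2))) * L (sq_norm ^ n * ?p) =
          L (sq_norm ^ Suc n * laplacian ?p)"
        using casimir_reduction[of n ?p] by (simp only: mult.left_commute[of "sq_norm ^ n"] of_nat_scale)
      also have "\<dots> = 0"
      proof -
        have "L (sq_norm ^ Suc n * partial j (partial j ?p)) = 0" for j
        proof (cases "lookup m j = 0")
          case True
          then show ?thesis by (simp add: partial_single partial.zero zero)
        next
          case nz: False
          \<comment> \<open>Exponent 1 needs no case of its own: the first subtraction lowers the
            degree, and the truncated second one never raises it.\<close>
          have "total_degree (m - single j 1 - single j 1) \<le> total_degree (m - single j 1)"
            by (simp add: total_degree_def lookup_minus sum_mono)
          also have "\<dots> < ?d"
            using total_degree_add[of "m - single j 1" "single j 1"] minus_single_add[of m j] nz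
            by (simp add: total_degree_single)
          finally show ?thesis
            unfolding partial_single by (rule less)
        qed
        then show ?thesis by (simp only: laplacian_def sum_distrib_left sum sum.neutral_const)
      qed
      finally show ?thesis
        by (simp only: of_nat_mult_eq_0_iff[OF contains_rat pos])
    qed
  qed
  from this[of 0] have "L (single m a) = 0" for m a
    by simp
  then show ?thesis
    by (intro additive_eqI[of L "\<lambda>_. 0" p] additive_axioms additive.intro) simp_all
qed

lemma harmonic_eq_constant_term:
  fixes p :: "('n, 'r) mpoly"
  assumes "harmonic p" "L 1 = 1"
  shows "L p = constant_term p"
proof -
  let ?c = "\<lambda>d. d * (d + (CARD('n) - 2))"
  have "\<exists>u :: 'r. u * of_nat (?c d) = 1" if "d > 0" for d
    by (rule of_nat_invertible[OF contains_rat, of "?c d"]) (use that in auto)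
  then obtain u :: "nat \<Rightarrow> 'r" where u: "\<And>d. d > 0 \<Longrightarrow> u d * of_nat (?c d) = 1"
    by metis
  \<comment> \<open>In degree 0 the eigenvalue is 0 and has no inverse; the value 0 removes the
    constant term.\<close>
  define v where "v d = (if d = 0 then 0 else u d)" for d
  define q where "q = (\<Sum>m\<in>keys p. single m (v (total_degree m) * lookup p m))"
  have q: "lookup q m = v (total_degree m) * lookup p m" for m
    by (simp add: q_def lookup_sum lookup_single when_def in_keys_iff)
  have "lookup (laplacian q) m = 0" for m
  proof -
    \<comment> \<open>The Laplacian lowers degrees by exactly 2, so all its summands at
      \<open>m\<close> carry the same factor \<open>v\<close>.\<close>
    have "lookup (laplacian q) m = v (total_degree m + 2) * lookup (laplacian p) m"
      by (simp add: laplacian_def lookup_sum lookup_partial q total_degree_add total_degree_single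
          sum_distrib_left algebra_simps)
    then show ?thesis using assms(1) by (simp add: harmonic_def)
  qed
  then have "laplacian q = 0"
    by (intro poly_mapping_eqI) simp
  moreover have "p - Const (constant_term p) =
      euler (euler q) + of_nat (CARD('n) - 2) * euler q"
  proof (rule poly_mapping_eqI)
    fix m
    have "lookup (euler (euler q) + of_nat (CARD('n) - 2) * euler q) m =
        (v (total_degree m) * of_nat (?c (total_degree m))) * lookup p m"
      unfolding lookup_add lookup_euler lookup_of_nat_mult q of_nat_mult of_nat_add
      by (simp add: algebra_simps)
    also have "\<dots> = lookup (p - Const (constant_term p)) m"
      using u[of "total_degree m"] total_degree_eq_0_iff[of m]
      by (cases "m = 0")
        (auto simp: v_def lookup_minus Const_def constant_term_def lookup_single when_def)
    finally show "lookup (p - Const (constant_term p)) m =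
        lookup (euler (euler q) + of_nat (CARD('n) - 2) * euler q) m" ..
  qed
  ultimately have "L (p - Const (constant_term p)) = 0"
    using casimir_reduction[of 0 q] by (simp add: zero)
  then show ?thesis
    using Const_scale[of "constant_term p" 1] assms(2) by (simp add: diff)
qed

end

section \<open>Existence of the spherical mean\<close>

text \<open>The moments $E[Z^n]$ of a standard normal variable; the recursion is integration by
  parts.\<close>

fun normal_moment :: "nat \<Rightarrow> rat"
  where
    "normal_moment 0 = 1"
  | "normal_moment (Suc 0) = 0"
  | "normal_moment (Suc (Suc n)) = of_nat (Suc n) * normal_moment n"

text \<open>Merges the last two equations: at $n = 0$ the truncated \<open>n - 1\<close> is harmless
  because of the factor 0.\<close>

lemma normal_moment_Suc: "normal_moment (Suc n) = of_nat n * normal_moment (n - 1)"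
  by (cases n) simp_all

lemma normal_moment_odd: "odd n \<Longrightarrow> normal_moment n = 0"
  by (induction n rule: normal_moment.induct) simp_all

definition normal_moments :: "('n::finite \<Rightarrow>\<^sub>0 nat) \<Rightarrow> rat"
  where "normal_moments m = (\<Prod>j\<in>UNIV. normal_moment (lookup m j))"

text \<open>For even $d$ this is $E[|Z|^d]$ for a standard normal vector $Z$ in $N$ dimensions. For
  odd $d$ the value is only a nonzero placeholder, since the normal moments then vanish.\<close>

definition radial_moment :: "'n::finite itself \<Rightarrow> nat \<Rightarrow> rat"
  where "radial_moment _ d = (\<Prod>i<d div 2. of_nat (CARD('n) + 2 * i))"

text \<open>The mean of $X^m$ over the unit sphere, because the norm and the direction of a normal
  vector are independent.\<close>

definition sphere_moment :: "('n::finite \<Rightarrow>\<^sub>0 nat) \<Rightarrow> rat"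
  where "sphere_moment m = normal_moments m / radial_moment TYPE('n) (total_degree m)"

text \<open>The right-hand side is symmetric in \<open>j\<close> and \<open>k\<close>, so the two
  terms of $M_{jk} X^m$ will cancel. The factor \<open>lookup m k\<close> covers the case of a
  truncated exponent.\<close>

lemma sphere_moment_rot:
  fixes m :: "'n::finite \<Rightarrow>\<^sub>0 nat"
  assumes "j \<noteq> k"
  shows "of_nat (lookup m k) * sphere_moment (m - single k 1 + single j 1) =
    of_nat (lookup m k) * of_nat (lookup m j) *
    (normal_moment (lookup m j - 1) * normal_moment (lookup m k - 1)) *
    (\<Prod>i\<in>UNIV - {j, k}. normal_moment (lookup m i)) / radial_moment TYPE('n) (total_degree m)"
proof (cases "lookup m k = 0")
  case False
  let ?m = "m - single k 1 + single j 1"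
  have deg: "total_degree ?m = total_degree m"
    using minus_single_add[of m k] total_degree_add[of "m - single k 1" "single k 1"] False
    by (simp add: total_degree_add total_degree_single)
  have "normal_moments ?m = (\<Prod>i\<in>{j, k}. normal_moment (lookup ?m i)) *
      (\<Prod>i\<in>UNIV - {j, k}. normal_moment (lookup ?m i))"
    unfolding normal_moments_def by (subst mult.commute, rule prod.subset_diff) auto
  also have "(\<Prod>i\<in>{j, k}. normal_moment (lookup ?m i)) =
      of_nat (lookup m j) * (normal_moment (lookup m j - 1) * normal_moment (lookup m k - 1))"
    using assms by (simp add: lookup_add lookup_minus lookup_single normal_moment_Suc)
  also have "(\<Prod>i\<in>UNIV - {j, k}. normal_moment (lookup ?m i)) =
      (\<Prod>i\<in>UNIV - {j, k}. normal_moment (lookup m i))"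
    by (rule prod.cong) (auto simp: lookup_add lookup_minus lookup_single when_def)
  finally show ?thesis
    unfolding sphere_moment_def deg by simp
qed simp

text \<open>Raising exponent $m_j$ by 2 multiplies the normal moment by $m_j + 1$. These factors sum
  to $N + d$, which is exactly the factor gained by the radial moment.\<close>

lemma sphere_moment_add_squares:
  fixes m :: "'n::finite \<Rightarrow>\<^sub>0 nat"
  shows "(\<Sum>j\<in>UNIV. sphere_moment (m + single j 2)) = sphere_moment m"
proof -
  have num: "normal_moments (m + single j 2) = of_nat (lookup m j + 1) * normal_moments m" for j
  proof -
    have "normal_moments (m + single j 2) =
        normal_moment (lookup m j + 2) * (\<Prod>i\<in>UNIV - {j}. normal_moment (lookup (m + single j 2) i))"
      unfolding normal_moments_def by (subst prod.remove[of _ j]) (auto simp: lookup_add)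
    also have "(\<Prod>i\<in>UNIV - {j}. normal_moment (lookup (m + single j 2) i)) =
        (\<Prod>i\<in>UNIV - {j}. normal_moment (lookup m i))"
      by (rule prod.cong) (auto simp: lookup_add lookup_single when_def)
    finally show ?thesis
      unfolding normal_moments_def by (subst prod.remove[of _ j]) auto
  qed
  have "(\<Sum>j\<in>UNIV. sphere_moment (m + single j 2)) =
      of_nat (CARD('n) + total_degree m) * normal_moments m /
      radial_moment TYPE('n) (total_degree m + 2)"
    unfolding sphere_moment_def num total_degree_add total_degree_single
    by (simp add: sum.distrib total_degree_def[of m] flip: sum_divide_distrib sum_distrib_right)
  also have "\<dots> = sphere_moment m"
  \<comment> \<open>If the normal moment is nonzero, all exponents are even, hence so is $d$, and
    the new radial factor $N + 2(d$ \<open>div\<close> $2)$ equals $N + d$.\<close>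
  proof (cases "normal_moments m = 0")
    case False
    then have "even (lookup m j)" for j
      using normal_moment_odd[of "lookup m j"] by (auto simp: normal_moments_def)
    then have "even (total_degree m)"
      unfolding total_degree_def by (intro dvd_sum) auto
    then have "radial_moment TYPE('n) (total_degree m + 2) =
        of_nat (CARD('n) + total_degree m) * radial_moment TYPE('n) (total_degree m)"
      by (simp add: radial_moment_def flip: of_nat_mult of_nat_add)
    moreover have "of_nat (CARD('n) + total_degree m) \<noteq> (0 :: rat)"
      by (simp add: card_eq_0_iff del: of_nat_add)
    ultimately show ?thesis by (simp add: sphere_moment_def)
  qed (simp add: sphere_moment_def)
  finally show ?thesis .
qed

section \<open>Linear functionals with prescribed moments\<close>

definition moment_functional ::
    "(('n::finite \<Rightarrow>\<^sub>0 nat) \<Rightarrow> 'r) \<Rightarrow> ('n, 'r::comm_ring_1) mpoly \<Rightarrow> 'r"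
  where "moment_functional w p = (\<Sum>m\<in>keys p. lookup p m * w m)"

text \<open>Cancellation can shrink the set of keys, so different polynomials are compared over a
  common finite index set.\<close>

lemma moment_functional_superset:
  assumes "finite S" "keys p \<subseteq> S"
  shows "moment_functional w p = (\<Sum>m\<in>S. lookup p m * w m)"
  unfolding moment_functional_def
  by (rule sum.mono_neutral_left) (use assms in \<open>auto simp: in_keys_iff\<close>)

lemma moment_functional_add:
  "moment_functional w (p + q) = moment_functional w p + moment_functional w q"
proof -
  let ?S = "keys p \<union> keys q"
  have "moment_functional w x = (\<Sum>m\<in>?S. lookup x m * w m)" if "x \<in> {p, q, p + q}" for x
    by (rule moment_functional_superset) (use that keys_add[of p q] in auto)
  then show ?thesis by (simp add: lookup_add distrib_right sum.distrib)
qed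

interpretation moment_functional: additive "moment_functional w"
  by standard (rule moment_functional_add)

lemma moment_functional_Const_mult:
  "moment_functional w (Const c * p) = c * moment_functional w p"
  by (subst moment_functional_superset[OF finite_keys keys_Const_mult])
    (simp add: moment_functional_def lookup_Const_mult sum_distrib_left mult.assoc)

lemma moment_functional_single: "moment_functional w (single m a) = a * w m"
  by (cases "a = 0") (simp_all add: moment_functional_def)

lemma module_mpoly:
  "module (\<lambda>(c::'r::comm_ring_1) (p :: ('n::finite, 'r) mpoly). Const c * p)"
  by standard (simp_all add: Const_add Const_mult Const_1 algebra_simps)

lemma module_self: "module ((*) :: 'r::comm_ring_1 \<Rightarrow> 'r \<Rightarrow> 'r)"
  by standard (simp_all add: algebra_simps)

lemma is_spherical_mean_moment_functional:
  fixes h :: "rat \<Rightarrow> 'r::comm_ring_1"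
  assumes h: "h 1 = 1" "\<And>x y. h (x + y) = h x + h y" "\<And>x y. h (x * y) = h x * h y"
    "\<And>n. h (of_nat n) = of_nat n" "h 0 = 0"
  shows "is_spherical_mean
    (moment_functional (\<lambda>m. h (sphere_moment m)) :: ('n::finite, 'r) mpoly \<Rightarrow> 'r)"
proof -
  let ?L = "moment_functional (\<lambda>m. h (sphere_moment m)) :: ('n, 'r) mpoly \<Rightarrow> 'r"
  have hom: "module_hom (\<lambda>c p. Const c * p) (*) ?L"
    by (intro module_hom.intro module_mpoly module_self module_hom_axioms.intro
        moment_functional_add moment_functional_Const_mult)
  have rot: "?L (rot j k p) = 0" if jk: "j \<noteq> k" for j k p
  proof (rule additive_eqI[of "\<lambda>p. ?L (rot j k p)" "\<lambda>p. 0"])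
    fix m and a :: 'r
    have L_summand: "?L (Var j * partial k (single m a)) =
        a * h (of_nat (lookup m k) * sphere_moment (m - single k 1 + single j 1))" for j k
      by (simp add: Var_def partial_single mult_single moment_functional_single h(3,4) ac_simps)
    have "of_nat (lookup m k) * sphere_moment (m - single k 1 + single j 1) =
        of_nat (lookup m j) * sphere_moment (m - single j 1 + single k 1)"
      unfolding sphere_moment_rot[OF jk] sphere_moment_rot[OF jk[symmetric]]
      by (simp add: mult_ac insert_commute)
    then show "?L (rot j k (single m a)) = 0"
      unfolding rot_def moment_functional.diff L_summand by simp
  qed (unfold_locales,
      simp_all add: rot_def partial_add distrib_left moment_functional.diff moment_functional.add)
  have sum_h: "h (sum f A) = (\<Sum>x\<in>A. h (f x))" for f :: "'n \<Rightarrow> rat" and A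
    using h(2) by (intro additive.sum) (simp add: additive_def)
  \<comment> \<open>Multiplication by $r^2$ does not change the mean, so the normalization on all
    powers follows from \<open>?L 1 = 1\<close>.\<close>
  have sq: "?L (sq_norm * p) = ?L p" for p
  proof (rule additive_eqI[of "\<lambda>p. ?L (sq_norm * p)" ?L])
    fix m :: "'n \<Rightarrow>\<^sub>0 nat" and a :: 'r
    have "sq_norm * single m a = (\<Sum>j\<in>UNIV. single (m + single j 2) a)"
      by (simp add: sq_norm_def Var_def power2_eq_square mult_single sum_distrib_right
          add.commute numeral_2_eq_2 flip: single_add)
    then show "?L (sq_norm * single m a) = ?L (single m a)"
      by (simp add: moment_functional.sum moment_functional_single
          flip: sum_distrib_left sum_h sphere_moment_add_squares[of m])
  qed (unfold_locales, simp_all add: distrib_left moment_functional.add)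
  have "?L 1 = 1"
    using moment_functional_single[of "\<lambda>m. h (sphere_moment m)" 0 1] h(1)
    by (simp add: sphere_moment_def normal_moments_def radial_moment_def total_degree_0)
  then have "?L (sq_norm ^ n) = 1" for n
    by (induction n) (simp_all add: sq)
  then show ?thesis
    using hom rot by (simp add: is_spherical_mean_def sq_norm_def)
qed

section \<open>Uniqueness\<close>

lemma rotation_invariant_if_is_spherical_mean:
  fixes L :: "('n::finite, 'r::comm_ring_1) mpoly \<Rightarrow> 'r"
  assumes "is_spherical_mean L" "contains_rat TYPE('r)" "CARD('n) \<ge> 2"
  shows "rotation_invariant L"
proof -
  interpret module_hom "\<lambda>c p. Const c * p" "(*)" L
    using assms(1) by (simp add: is_spherical_mean_def)
  show ?thesis
    using assms by unfold_locales (auto simp: is_spherical_mean_def add scale)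
qed

lemma is_spherical_mean_unique:
  fixes L L' :: "('n::finite, 'r::comm_ring_1) mpoly \<Rightarrow> 'r"
  assumes L: "is_spherical_mean L" "is_spherical_mean L'"
    and R: "contains_rat TYPE('r)" "CARD('n) \<ge> 2"
  shows "L = L'"
proof
  fix p
  interpret A: rotation_invariant L
    using L(1) R by (rule rotation_invariant_if_is_spherical_mean)
  interpret B: rotation_invariant L'
    using L(2) R by (rule rotation_invariant_if_is_spherical_mean)
  \<comment> \<open>The difference kills the rotations and vanishes on all powers of $r^2$, hence
    everywhere.\<close>
  interpret D: rotation_invariant "\<lambda>p. L p - L' p"
    by unfold_locales
      (auto simp: A.add B.add A.Const_scale B.Const_scale A.rot B.rot R right_diff_distrib)
  have "L (sq_norm ^ n) - L' (sq_norm ^ n) = 0" for n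
    using L by (simp add: is_spherical_mean_def sq_norm_def)
  from D.zero_if_zero_on_sq_norm_powers[OF this] show "L p = L' p" by simp
qed

lemma is_spherical_mean_spherical_mean:
  assumes "contains_rat TYPE('r::comm_ring_1)" "CARD('n::finite) \<ge> 2"
  shows "is_spherical_mean (spherical_mean :: ('n, 'r) mpoly \<Rightarrow> 'r)"
proof -
  obtain h :: "rat \<Rightarrow> 'r" where h: "h 1 = 1" "\<And>x y. h (x + y) = h x + h y"
    "\<And>x y. h (x * y) = h x * h y" "\<And>n. h (of_nat n) = of_nat n" "h 0 = 0"
    by (rule contains_rat_hom[OF assms(1)]) (rule that)
  note L = is_spherical_mean_moment_functional[of h, OF h, where 'n = 'n]
  show ?thesis
    unfolding spherical_mean_def
    by (rule theI[of _ "moment_functional (\<lambda>m. h (sphere_moment m))"])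
      (rule L, rule is_spherical_mean_unique[OF _ L assms])
qed

theorem corollary4p8:
  fixes p :: "('n::finite, 'r::comm_ring_1) mpoly"
  assumes "contains_rat TYPE('r)"
    and "CARD('n) \<ge> 2"
    and "harmonic p"
  shows "spherical_mean p = constant_term p"
proof -
  have L: "is_spherical_mean (spherical_mean :: ('n, 'r) mpoly \<Rightarrow> 'r)"
    using assms(1,2) by (rule is_spherical_mean_spherical_mean)
  then interpret rotation_invariant "spherical_mean :: ('n, 'r) mpoly \<Rightarrow> 'r"
    using assms(1,2) by (rule rotation_invariant_if_is_spherical_mean)
  \<comment> \<open>The zeroth power of $r^2$ gives the value 1 at the polynomial 1.\<close>
  from L have "spherical_mean ((\<Sum>j\<in>UNIV. Var j ^ 2) ^ 0 :: ('n, 'r) mpoly) = 1"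
    unfolding is_spherical_mean_def by blast
  then show ?thesis
    using assms(3) by (intro harmonic_eq_constant_term) simp_all
qed

end
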